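(* Let $\alpha\in(0,1]$ and $h\in\mathcal{G}(\alpha)$. Then $\|S_h\|\le 2\alpha(2+\alpha)$. Equality is attained by the function $h$ (with $h(0)=0$) determined by $h'(z)=(1-\zeta z)^\alpha$, where $\zeta\in\mathbb{T}$.
   Context: $\mathbb{D}=\{z\in\mathbb{C}:|z|<1\}$ and $\mathbb{T}=\{z\in\mathbb{C}:|z|=1\}$. For $0<\alpha\le 1$, $\mathcal{G}(\alpha)$ is the family of locally univalent analytic functions $h:\mathbb{D}\to\mathbb{C}$ (so $h'\neq0$ in $\mathbb{D}$) with $h(0)=0$, $h'(0)=1$ and $\operatorname{Re}\left(\frac{zh''(z)}{\alpha h'(z)}\right)<\frac12$ for every $z\in\mathbb{D}$. For a locally univalent analytic function $h$ in $\mathbb{D}$, the Schwarzian derivative is $S_h=\left(\frac{h''}{h'}\right)'-\frac12\left(\frac{h''}{h'}\right)^2$, and its norm is $\|S_h\|=\sup_{z\in\mathbb{D}}(1-|z|^2)^2|S_h(z)|$. The power $(1-\zeta z)^\alpha$ is taken with the principal branch, equal to $1$ at $z=0$. *)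

theory Defs
  imports "HOL-Complex_Analysis.Complex_Analysis" "HOL-Library.Extended_Real"
begin

abbreviation unit_disc :: "complex set" where
  "unit_disc \<equiv> ball 0 1"

definition locally_univalent_on :: "(complex \<Rightarrow> complex) \<Rightarrow> complex set \<Rightarrow> bool" where
  "locally_univalent_on h A \<longleftrightarrow>
     (\<forall>z\<in>A. \<exists>U. open U \<and> z \<in> U \<and> U \<subseteq> A \<and> inj_on h U)"

definition class_G :: "real \<Rightarrow> (complex \<Rightarrow> complex) set" where
  "class_G \<alpha> = {h. h holomorphic_on unit_disc \<and> locally_univalent_on h unit_disc \<and>
     h 0 = 0 \<and> deriv h 0 = 1 \<and>
     (\<forall>z\<in>unit_disc. Re (z * deriv (deriv h) z / (of_real \<alpha> * deriv h z)) < 1/2)}"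

definition schwarzian :: "(complex \<Rightarrow> complex) \<Rightarrow> complex \<Rightarrow> complex" where
  "schwarzian h z =
     deriv (\<lambda>w. deriv (deriv h) w / deriv h w) z - 1/2 * (deriv (deriv h) z / deriv h z)\<^sup>2"

(* The supremum is taken in the extended reals, where an unbounded Schwarzian has norm \<infinity>;
   a supremum in type real would be unspecified in that case. *)
definition schwarzian_norm :: "(complex \<Rightarrow> complex) \<Rightarrow> ereal" where
  "schwarzian_norm h = (SUP z\<in>unit_disc. ereal ((1 - (cmod z)\<^sup>2)\<^sup>2 * cmod (schwarzian h z)))"

(* For |\<zeta>| = 1 and |z| < 1 the number 1 - \<zeta> z lies in the right half-plane, so powr, which is
   defined through the principal logarithm, is the branch with value 1 at z = 0. The conditions
   determine h on the disc only; its values elsewhere are irrelevant. *)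
definition is_extremal :: "real \<Rightarrow> complex \<Rightarrow> (complex \<Rightarrow> complex) \<Rightarrow> bool" where
  "is_extremal \<alpha> \<zeta> h \<longleftrightarrow> h holomorphic_on unit_disc \<and> h 0 = 0 \<and>
     (\<forall>z\<in>unit_disc. deriv h z = (1 - \<zeta> * z) powr of_real \<alpha>)"

end

theory Submission imports Defs begin

text \<open>The condition on \<open>u = z h'' / (\<alpha> h')\<close> says that \<open>u / (u - 1)\<close> maps the disc into itself. It
  vanishes at 0, so by the Schwarz lemma it equals \<open>z \<phi>(z)\<close> with \<open>|\<phi>| \<le> 1\<close>; hence
  \<open>h'' / h' = - \<alpha> \<phi> / (1 - z \<phi>)\<close> and
  \<open>S\<^sub>h = - \<alpha> (\<phi>' + (1 + \<alpha>/2) \<phi>\<^sup>2) / (1 - z \<phi>)\<^sup>2\<close>. The Schwarz-Pick bound for \<open>\<phi>'\<close> reduces the estimate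
  to a real inequality in \<open>r = |z|\<close> and \<open>t = |\<phi>(z)|\<close>. The extremal functions have \<open>\<phi>\<close> constantly
  \<open>\<zeta>\<close>, and the bound is approached along the radius towards \<open>cnj \<zeta>\<close>.\<close>

section \<open>The Schwarz-Pick inequality\<close>

lemma Moebius_function_has_field_derivative:
  assumes "1 - cnj w * z \<noteq> 0"
  shows "(Moebius_function 0 w has_field_derivative (1 - cnj w * w) / (1 - cnj w * z)\<^sup>2) (at z)"
proof -
  have "((\<lambda>z. (z - w) / (1 - cnj w * z)) has_field_derivative
      (1 - cnj w * w) / (1 - cnj w * z)\<^sup>2) (at z)"
    using assms
    by (auto intro!: derivative_eq_intros simp: divide_simps power2_eq_square) (simp add: algebra_simps)
  then show ?thesis
    by (simp add: Moebius_function_simple[abs_def])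
qed

lemma one_minus_cnj_mult_self: "1 - cnj w * w = of_real (1 - (cmod w)\<^sup>2)"
  using complex_norm_square[of w] by (simp add: mult.commute)

text \<open>Schwarz's lemma at 0 applies to \<open>f\<close> composed with two disc automorphisms,
  one taking 0 to \<open>a\<close>, the other taking \<open>f a\<close> to 0. The chain rule turns
  the resulting bound on \<open>deriv g 0\<close> into the claim.\<close>

lemma Schwarz_Pick_strict:
  assumes hol: "f holomorphic_on ball 0 1"
    and lt: "\<And>z. cmod z < 1 \<Longrightarrow> cmod (f z) < 1"
    and a: "cmod a < 1"
  shows "cmod (deriv f a) * (1 - (cmod a)\<^sup>2) \<le> 1 - (cmod (f a))\<^sup>2"
proof -
  define g where "g = Moebius_function 0 (f a) \<circ> (f \<circ> Moebius_function 0 (- a))"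
  have na: "cmod (- a) < 1" and fa: "cmod (f a) < 1"
    using a lt by auto
  have m0: "Moebius_function 0 (- a) 0 = a"
    by (simp add: Moebius_function_of_zero)
  have pa: "1 - (cmod a)\<^sup>2 > 0" and pf: "1 - (cmod (f a))\<^sup>2 > 0"
    using a fa by (simp_all add: power_less_one_iff abs_square_less_1)
  have "f \<circ> Moebius_function 0 (- a) holomorphic_on ball 0 1"
    by (rule holomorphic_on_compose_gen[OF Moebius_function_holomorphic[OF na] hol])
       (use Moebius_function_norm_lt_1[OF na] in auto)
  then have holg: "g holomorphic_on ball 0 1"
    unfolding g_def
    by (rule holomorphic_on_compose_gen[OF _ Moebius_function_holomorphic[OF fa]])
       (use Moebius_function_norm_lt_1[OF na] lt in auto)
  have g0: "g 0 = 0"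
    by (simp add: g_def m0 Moebius_function_eq_zero)
  have glt: "cmod (g z) < 1" if "cmod z < 1" for z
    using Moebius_function_norm_lt_1[OF fa lt[OF Moebius_function_norm_lt_1[OF na that]]]
    by (simp add: g_def)
  have le: "cmod (deriv g 0) \<le> 1"
    by (rule Schwarz_Lemma(2)[OF holg g0 glt, of 0]) auto
  have nz: "1 - cnj (f a) * f a \<noteq> 0"
    using pf by (simp only: one_minus_cnj_mult_self of_real_eq_0_iff)
  have d1: "(Moebius_function 0 (- a) has_field_derivative 1 - cnj a * a) (at 0)"
    using Moebius_function_has_field_derivative[of "- a" 0] by simp
  have d2: "(f has_field_derivative deriv f a) (at (Moebius_function 0 (- a) 0))"
    unfolding m0 using hol a by (simp add: holomorphic_derivI)
  have d3: "(Moebius_function 0 (f a) has_field_derivative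
      (1 - cnj (f a) * f a) / (1 - cnj (f a) * f a)\<^sup>2) (at ((f \<circ> Moebius_function 0 (- a)) 0))"
    using Moebius_function_has_field_derivative[OF nz] by (simp add: m0)
  have "deriv g 0 = (1 - cnj (f a) * f a) / (1 - cnj (f a) * f a)\<^sup>2 * (deriv f a * (1 - cnj a * a))"
    unfolding g_def by (rule DERIV_imp_deriv[OF DERIV_chain[OF d3 DERIV_chain[OF d2 d1]]])
  also have "\<dots> = deriv f a * of_real (1 - (cmod a)\<^sup>2) / of_real (1 - (cmod (f a))\<^sup>2)"
    using nz unfolding one_minus_cnj_mult_self[symmetric] by (simp add: power2_eq_square)
  finally have "cmod (deriv g 0) = cmod (deriv f a) * (1 - (cmod a)\<^sup>2) / (1 - (cmod (f a))\<^sup>2)"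
    using pa pf by (simp only: norm_mult norm_divide norm_of_real abs_of_pos)
  with le pf show ?thesis
    by (simp add: field_simps)
qed

text \<open>Values on the unit circle are allowed here; scaling by \<open>s < 1\<close> reduces to the strict case
  without a discussion of unimodular constants.\<close>

lemma Schwarz_Pick:
  assumes hol: "f holomorphic_on ball 0 1"
    and le: "\<And>z. cmod z < 1 \<Longrightarrow> cmod (f z) \<le> 1"
    and a: "cmod a < 1"
  shows "cmod (deriv f a) * (1 - (cmod a)\<^sup>2) \<le> 1 - (cmod (f a))\<^sup>2"
proof -
  have scaled: "s * cmod (deriv f a) * (1 - (cmod a)\<^sup>2) \<le> 1 - (s * cmod (f a))\<^sup>2"
    if s: "0 < s" "s < 1" for s :: real
  proof -
    have "cmod (deriv (\<lambda>z. of_real s * f z) a) * (1 - (cmod a)\<^sup>2) \<le> 1 - (cmod (of_real s * f a))\<^sup>2"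
    proof (rule Schwarz_Pick_strict)
      show "(\<lambda>z. of_real s * f z) holomorphic_on ball 0 1"
        by (intro holomorphic_intros hol)
      fix z :: complex assume "cmod z < 1"
      then have "s * cmod (f z) \<le> s * 1"
        using le s by (intro mult_left_mono) auto
      then have "s * cmod (f z) < 1"
        using s by linarith
      then show "cmod (of_real s * f z) < 1"
        using s by (simp add: norm_mult)
    qed (rule a)
    moreover have "deriv (\<lambda>z. of_real s * f z) a = of_real s * deriv f a"
      using hol a by (intro deriv_cmult) (simp add: holomorphic_on_imp_differentiable_at)
    ultimately show ?thesis
      using s by (simp add: norm_mult)
  qed
  \<comment> \<open>Both sides are continuous in \<open>s\<close>, so the scaled bound survives the
    limit of \<open>s\<close> to 1 from the left.\<close>
  have ev: "\<forall>\<^sub>F s in at_left (1::real).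
      s * cmod (deriv f a) * (1 - (cmod a)\<^sup>2) \<le> 1 - (s * cmod (f a))\<^sup>2"
    by (rule eventually_mono[OF eventually_at_left_real[of 0 1]]) (auto intro: scaled)
  have "1 * cmod (deriv f a) * (1 - (cmod a)\<^sup>2) \<le> 1 - (1 * cmod (f a))\<^sup>2"
    by (rule tendsto_le[OF trivial_limit_at_left_real _ _ ev]) (intro tendsto_intros)+
  then show ?thesis by simp
qed

section \<open>The real inequality and the Schwarzian formula\<close>

text \<open>In the application r = |z|, t = |\<phi>(z)| and k = 1 + \<alpha>/2. Both sides are
  affine in k, so it suffices to add the case k = 1 to (k - 1) times the comparison of the
  coefficients of k. The constant 4 is sharp: take t = 1 and let r tend to 1.\<close>

lemma disc_weight_bound:
  fixes r t k :: real
  assumes r: "0 \<le> r" "r < 1" and t: "0 \<le> t" "t \<le> 1" and k: "1 \<le> k"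
  shows "(1 - r\<^sup>2) * (1 - t\<^sup>2) + k * t\<^sup>2 * (1 - r\<^sup>2)\<^sup>2 \<le> 4 * k * (1 - r * t)\<^sup>2"
proof -
  have rt: "r * t \<le> r" "0 \<le> r * t"
    using r t by (simp_all add: mult_left_le)
  have r2: "0 \<le> 1 - r\<^sup>2"
    using r by (simp add: power_le_one)
  \<comment> \<open>The left side factors as (1 - r^2)(1 - rt)(1 + rt). Now 1 - r \<le> 1 - rt, and
    (1 + r)(1 + rt) \<le> 4.\<close>
  have one: "(1 - r\<^sup>2) * (1 - t\<^sup>2) + t\<^sup>2 * (1 - r\<^sup>2)\<^sup>2 \<le> 4 * (1 - r * t)\<^sup>2"
  proof -
    have "(1 - r\<^sup>2) * (1 + r * t) = (1 - r) * ((1 + r) * (1 + r * t))"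
      by (simp add: algebra_simps power2_eq_square)
    also have "\<dots> \<le> (1 - r * t) * (2 * 2)"
      using r rt by (intro mult_mono) auto
    finally have "(1 - r * t) * ((1 - r\<^sup>2) * (1 + r * t)) \<le> (1 - r * t) * ((1 - r * t) * 4)"
      using r rt by (intro mult_left_mono) auto
    then show ?thesis
      by (simp add: algebra_simps power2_eq_square)
  qed
  have "t * (1 - r\<^sup>2) \<le> 2 * (1 - r * t)"
  proof -
    \<comment> \<open>Here 1 + 2r - r^2 = 2 - (1 - r)^2 \<le> 2.\<close>
    have "t * (1 + 2 * r - r\<^sup>2) \<le> 1 * 2"
      using r t r2 zero_le_power2[of "1 - r"]
      by (intro mult_mono) (auto simp: algebra_simps power2_eq_square)
    then show ?thesis by (simp add: algebra_simps)
  qed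
  then have "(t * (1 - r\<^sup>2))\<^sup>2 \<le> (2 * (1 - r * t))\<^sup>2"
    using t r2 by (intro power_mono) auto
  then have "(k - 1) * (t * (1 - r\<^sup>2))\<^sup>2 \<le> (k - 1) * (2 * (1 - r * t))\<^sup>2"
    using k by (intro mult_left_mono) auto
  then have "(k - 1) * (t\<^sup>2 * (1 - r\<^sup>2)\<^sup>2) \<le> (k - 1) * (4 * (1 - r * t)\<^sup>2)"
    by (simp only: power_mult_distrib) simp
  with one show ?thesis
    unfolding left_diff_distrib mult_1_left mult.assoc[symmetric] mult.commute[of k 4]
    by linarith
qed

text \<open>In the derivative of \<phi>/(1 - w \<phi>) the terms in w \<phi> \<phi>' cancel and
  leave (\<phi>' + \<phi>^2)/(1 - w \<phi>)^2; the squared term of the Schwarzian contributes the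
  a/2. The general \<phi> serves both the upper bound and the extremal functions, for which it is
  constant.\<close>

lemma schwarzian_eq:
  assumes A: "open A" "z \<in> A" and hol: "\<phi> holomorphic_on A"
    and nz: "\<And>w. w \<in> A \<Longrightarrow> 1 - w * \<phi> w \<noteq> 0"
    and eq: "\<And>w. w \<in> A \<Longrightarrow> deriv (deriv h) w / deriv h w = - a * \<phi> w / (1 - w * \<phi> w)"
  shows "schwarzian h z = - a * (deriv \<phi> z + (1 + a / 2) * (\<phi> z)\<^sup>2) / (1 - z * \<phi> z)\<^sup>2"
proof -
  have d: "(\<phi> has_field_derivative deriv \<phi> z) (at z)"
    using hol A by (rule holomorphic_derivI)
  have "((\<lambda>w. - a * \<phi> w / (1 - w * \<phi> w)) has_field_derivative
      - a * (deriv \<phi> z + (\<phi> z)\<^sup>2) / (1 - z * \<phi> z)\<^sup>2) (at z)"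
    using nz[OF A(2)] by (auto intro!: derivative_eq_intros d simp: power2_eq_square)
      (simp add: field_simps)
  then have "((\<lambda>w. deriv (deriv h) w / deriv h w) has_field_derivative
      - a * (deriv \<phi> z + (\<phi> z)\<^sup>2) / (1 - z * \<phi> z)\<^sup>2) (at z)"
    by (rule has_field_derivative_transform_within_open[OF _ A]) (simp add: eq)
  then have "deriv (\<lambda>w. deriv (deriv h) w / deriv h w) z
      = - a * (deriv \<phi> z + (\<phi> z)\<^sup>2) / (1 - z * \<phi> z)\<^sup>2"
    by (rule DERIV_imp_deriv)
  \<comment> \<open>For D = 0 both sides are 0, as division by zero yields 0.\<close>
  moreover have "- a * (d + p\<^sup>2) / D\<^sup>2 - 1/2 * (- a * p / D)\<^sup>2
      = - a * (d + (1 + a / 2) * p\<^sup>2) / D\<^sup>2" for d p D :: complex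
    by (cases "D = 0") (auto simp: field_simps power2_eq_square)
  ultimately show ?thesis
    unfolding schwarzian_def eq[OF A(2)] by simp
qed

section \<open>Local univalence, and the upper bound on the class\<close>

lemma locally_univalent_on_deriv_nonzero:
  assumes "locally_univalent_on h A" "h holomorphic_on A" "z \<in> A"
  shows "deriv h z \<noteq> 0"
proof -
  obtain U where "open U" "z \<in> U" "U \<subseteq> A" "inj_on h U"
    using assms unfolding locally_univalent_on_def by blast
  then show ?thesis
    using holomorphic_injective_imp_regular[of h U z] assms(2) holomorphic_on_subset by blast
qed

lemma locally_univalent_onI:
  assumes "h holomorphic_on A" "open A" "\<And>z. z \<in> A \<Longrightarrow> deriv h z \<noteq> 0"
  shows "locally_univalent_on h A"
  unfolding locally_univalent_on_def
proof
  fix z assume z: "z \<in> A"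
  obtain r where "r > 0" "ball z r \<subseteq> A" "inj_on h (ball z r)"
    using has_complex_derivative_locally_injective[OF assms(1) z assms(2) assms(3)[OF z]] .
  then show "\<exists>U. open U \<and> z \<in> U \<and> U \<subseteq> A \<and> inj_on h U"
    by (intro exI[of _ "ball z r"]) auto
qed

text \<open>The half-plane consists of the points nearer to 0 than to 1; this is what makes |u/(u -
  1)| < 1.\<close>

lemma norm_less_norm_minus_one:
  fixes u :: complex
  assumes "Re u < 1/2"
  shows "cmod u < cmod (u - 1)"
proof -
  have "(cmod (u - 1))\<^sup>2 = (cmod u)\<^sup>2 + 1 - 2 * Re u"
    by (simp only: cmod_power2) (simp add: power2_eq_square algebra_simps)
  with assms have "(cmod u)\<^sup>2 < (cmod (u - 1))\<^sup>2"
    by simp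
  then show ?thesis
    by (rule power_less_imp_less_base) simp
qed

lemma class_G_representation:
  assumes \<alpha>: "0 < \<alpha>" and h: "h \<in> class_G \<alpha>"
  obtains \<phi> where "\<phi> holomorphic_on unit_disc"
    and "\<And>z. cmod z < 1 \<Longrightarrow> cmod (\<phi> z) \<le> 1"
    and "\<And>z. z \<in> unit_disc \<Longrightarrow>
      deriv (deriv h) z / deriv h z = - of_real \<alpha> * \<phi> z / (1 - z * \<phi> z)"
proof
  define P where "P = (\<lambda>z. deriv (deriv h) z / deriv h z)"
  \<comment> \<open>With u = z P/\<alpha> this is u/(u - 1) divided by z. The factor z cancels in
    the formula itself, so no removable singularity arises at 0.\<close>
  define \<phi> where "\<phi> = (\<lambda>z. P z / (z * P z - of_real \<alpha>))"
  have holh: "h holomorphic_on unit_disc" and loc: "locally_univalent_on h unit_disc"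
    and re: "\<And>z. z \<in> unit_disc \<Longrightarrow> Re (z * deriv (deriv h) z / (of_real \<alpha> * deriv h z)) < 1/2"
    using h by (auto simp: class_G_def)
  have nzh: "deriv h z \<noteq> 0" if "z \<in> unit_disc" for z
    using locally_univalent_on_deriv_nonzero[OF loc holh that] .
  have holP: "P holomorphic_on unit_disc"
    unfolding P_def using nzh by (intro holomorphic_intros holh) auto
  have lt: "cmod (z * P z) < cmod (z * P z - of_real \<alpha>)" if "z \<in> unit_disc" for z
  proof -
    have "cmod (z * P z / of_real \<alpha>) < cmod (z * P z / of_real \<alpha> - 1)"
      using re[OF that] by (intro norm_less_norm_minus_one) (simp add: P_def mult.commute)
    also have "z * P z / of_real \<alpha> - 1 = (z * P z - of_real \<alpha>) / of_real \<alpha>"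
      using \<alpha> by (simp add: diff_divide_distrib)
    finally show ?thesis
      using \<alpha> by (simp add: norm_divide divide_less_cancel)
  qed
  have nz: "z * P z - of_real \<alpha> \<noteq> 0" if "z \<in> unit_disc" for z
    using lt[OF that] by auto
  show hol\<phi>: "\<phi> holomorphic_on unit_disc"
    unfolding \<phi>_def using nz by (intro holomorphic_intros holP) auto
  have hol: "(\<lambda>z. z * \<phi> z) holomorphic_on ball 0 1"
    by (intro holomorphic_intros hol\<phi>)
  have lt1: "cmod (z * \<phi> z) < 1" if "cmod z < 1" for z
    using lt[of z] nz[of z] that by (simp add: \<phi>_def norm_mult norm_divide divide_less_eq)
  show "cmod (\<phi> z) \<le> 1" if z: "cmod z < 1" for z
  \<comment> \<open>Away from 0 the bound |z \<phi>(z)| \<le> |z| can be divided by |z|. At 0 the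
    derivative part of Schwarz's lemma takes over, since \<phi>(0) is the derivative of z \<phi>(z)
    there.\<close>
  proof (cases "z = 0")
    case True
    have "(\<phi> has_field_derivative deriv \<phi> 0) (at 0)"
      using holomorphic_derivI[OF hol\<phi>, of 0] by simp
    then have "((\<lambda>z. z * \<phi> z) has_field_derivative \<phi> 0) (at 0)"
      by (auto intro!: derivative_eq_intros)
    then have "deriv (\<lambda>z. z * \<phi> z) 0 = \<phi> 0"
      by (rule DERIV_imp_deriv)
    then show ?thesis
      using Schwarz_Lemma(2)[OF hol _ lt1 z] True by simp
  next
    case False
    then show ?thesis
      using Schwarz_Lemma(1)[OF hol _ lt1 z] by (simp add: norm_mult)
  qed
  show "deriv (deriv h) z / deriv h z = - of_real \<alpha> * \<phi> z / (1 - z * \<phi> z)"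
    if z: "z \<in> unit_disc" for z
  proof -
    have "1 - z * \<phi> z = - of_real \<alpha> / (z * P z - of_real \<alpha>)"
      using nz[OF z] by (simp add: \<phi>_def field_simps)
    then have "P z = - of_real \<alpha> * \<phi> z / (1 - z * \<phi> z)"
      using nz[OF z] \<alpha> by (simp add: \<phi>_def)
    then show ?thesis by (simp add: P_def)
  qed
qed

lemma class_G_schwarzian_bound:
  assumes \<alpha>: "0 < \<alpha>" and h: "h \<in> class_G \<alpha>" and z: "z \<in> unit_disc"
  shows "(1 - (cmod z)\<^sup>2)\<^sup>2 * cmod (schwarzian h z) \<le> 2 * \<alpha> * (2 + \<alpha>)"
proof -
  obtain \<phi> where hol: "\<phi> holomorphic_on unit_disc"
    and le: "\<And>z. cmod z < 1 \<Longrightarrow> cmod (\<phi> z) \<le> 1"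
    and eq: "\<And>z. z \<in> unit_disc \<Longrightarrow>
      deriv (deriv h) z / deriv h z = - of_real \<alpha> * \<phi> z / (1 - z * \<phi> z)"
    by (rule class_G_representation[OF \<alpha> h]) blast
  \<comment> \<open>\<open>k\<close> is the coefficient of \<phi>^2 in the Schwarzian, and 4
    \<alpha> k = 2 \<alpha> (2 + \<alpha>) is the bound sought.\<close>
  define r t k where "r = cmod z" and "t = cmod (\<phi> z)" and "k = 1 + \<alpha> / 2"
  have r: "0 \<le> r" "r < 1" and t: "0 \<le> t" "t \<le> 1" and k: "1 \<le> k"
    using z le \<alpha> by (auto simp: r_def t_def k_def)
  have lt: "cmod (w * \<phi> w) < 1" if "w \<in> unit_disc" for w
  proof -
    have "cmod w * cmod (\<phi> w) \<le> cmod w"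
      using le[of w] that by (intro mult_left_le) auto
    then show ?thesis using that by (simp add: norm_mult)
  qed
  have nz: "1 - w * \<phi> w \<noteq> 0" if "w \<in> unit_disc" for w
    using lt[OF that] by auto
  have den: "0 < 1 - r * t" "1 - r * t \<le> cmod (1 - z * \<phi> z)"
    using lt[OF z] norm_triangle_ineq2[of 1 "z * \<phi> z"] by (auto simp: r_def t_def norm_mult)
  have r2: "0 \<le> 1 - r\<^sup>2"
    using r by (simp add: power_le_one)
  have S: "schwarzian h z =
      - of_real \<alpha> * (deriv \<phi> z + of_real k * (\<phi> z)\<^sup>2) / (1 - z * \<phi> z)\<^sup>2"
    using schwarzian_eq[OF open_ball z hol nz eq] by (simp add: k_def)
  have "cmod (deriv \<phi> z + of_real k * (\<phi> z)\<^sup>2) \<le> cmod (deriv \<phi> z) + k * t\<^sup>2"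
    using norm_triangle_ineq[of "deriv \<phi> z" "of_real k * (\<phi> z)\<^sup>2"] k
    by (simp add: norm_mult norm_power t_def)
  then have "(1 - r\<^sup>2)\<^sup>2 * cmod (deriv \<phi> z + of_real k * (\<phi> z)\<^sup>2)
      \<le> (1 - r\<^sup>2)\<^sup>2 * (cmod (deriv \<phi> z) + k * t\<^sup>2)"
    by (intro mult_left_mono) auto
  \<comment> \<open>One factor 1 - r^2 of the weight is spent on Schwarz-Pick for \<phi>'; the other
    remains.\<close>
  also have "\<dots> = (1 - r\<^sup>2) * (cmod (deriv \<phi> z) * (1 - r\<^sup>2)) + k * t\<^sup>2 * (1 - r\<^sup>2)\<^sup>2"
    by (simp add: algebra_simps power2_eq_square)
  also have "\<dots> \<le> (1 - r\<^sup>2) * (1 - t\<^sup>2) + k * t\<^sup>2 * (1 - r\<^sup>2)\<^sup>2"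
    using Schwarz_Pick[OF hol le, of z] z r2
    by (intro add_right_mono mult_left_mono) (auto simp: r_def t_def)
  also have "\<dots> \<le> 4 * k * (1 - r * t)\<^sup>2"
    by (rule disc_weight_bound[OF r t k])
  \<comment> \<open>The right side now carries the denominator of \<open>S\<close>, which
    cancels.\<close>
  also have "\<dots> \<le> 4 * k * (cmod (1 - z * \<phi> z))\<^sup>2"
    using den k by (intro mult_left_mono power_mono) auto
  finally have "\<alpha> * ((1 - r\<^sup>2)\<^sup>2 * cmod (deriv \<phi> z + of_real k * (\<phi> z)\<^sup>2))
      \<le> \<alpha> * (4 * k * (cmod (1 - z * \<phi> z))\<^sup>2)"
    using \<alpha> by (intro mult_left_mono) auto
  moreover have "cmod (1 - z * \<phi> z) > 0"
    using nz[OF z] by simp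
  ultimately have "(1 - r\<^sup>2)\<^sup>2 * cmod (schwarzian h z) \<le> \<alpha> * (4 * k)"
    using \<alpha> unfolding S by (simp add: norm_mult norm_divide norm_power divide_le_eq mult_ac)
  then show ?thesis
    by (simp add: r_def k_def algebra_simps)
qed

section \<open>The extremal functions\<close>

lemma Re_one_minus_pos:
  assumes "cmod \<zeta> = 1" "z \<in> unit_disc"
  shows "0 < Re (1 - \<zeta> * z)"
  using complex_Re_le_cmod[of "\<zeta> * z"] assms by (simp add: norm_mult del: times_complex.sel)

text \<open>The power with exponent a - 1 is written as a quotient, so that the logarithmic
  derivative stands in front of the original power.\<close>

lemma has_field_derivative_one_minus_powr:
  assumes "cmod \<zeta> = 1" "z \<in> unit_disc"
  shows "((\<lambda>z. (1 - \<zeta> * z) powr a) has_field_derivative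
    - a * \<zeta> / (1 - \<zeta> * z) * (1 - \<zeta> * z) powr a) (at z)"
proof -
  have pos: "0 < Re (1 - \<zeta> * z)"
    by (rule Re_one_minus_pos[OF assms])
  \<comment> \<open>A positive real part excludes both zero and the branch cut of the principal
    logarithm.\<close>
  then have nz: "1 - \<zeta> * z \<noteq> 0" and np: "1 - \<zeta> * z \<notin> \<real>\<^sub>\<le>\<^sub>0"
    by (auto simp: complex_nonpos_Reals_iff simp del: times_complex.sel)
  show ?thesis
    using np nz by (auto intro!: derivative_eq_intros simp: powr_diff)
qed

text \<open>This keeps the claim about all extremal functions from being vacuous. The disc is
  convex, so the prescribed derivative has a primitive there; subtracting its value at 0 normalises
  it.\<close>

lemma exists_is_extremal:
  assumes "cmod \<zeta> = 1"
  shows "\<exists>h. is_extremal \<alpha> \<zeta> h"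
proof -
  have "(\<lambda>z. (1 - \<zeta> * z) powr of_real \<alpha>) holomorphic_on unit_disc"
    unfolding holomorphic_on_open[OF open_ball]
    using has_field_derivative_one_minus_powr[OF assms] by blast
  then obtain g where g: "\<And>z. z \<in> unit_disc \<Longrightarrow>
      (g has_field_derivative (1 - \<zeta> * z) powr of_real \<alpha>) (at z within unit_disc)"
    using holomorphic_convex_primitive'[OF convex_ball open_ball] by blast
  then have d: "((\<lambda>z. g z - g 0) has_field_derivative (1 - \<zeta> * z) powr of_real \<alpha>) (at z)"
    if "z \<in> unit_disc" for z
    using that g[OF that] by (auto intro!: derivative_eq_intros simp: at_within_open[OF that open_ball])
  then have "is_extremal \<alpha> \<zeta> (\<lambda>z. g z - g 0)"
    unfolding is_extremal_def holomorphic_on_open[OF open_ball]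
    using DERIV_imp_deriv[OF d] by (intro conjI ballI) (blast, simp_all)
  then show ?thesis
    by (rule exI[where P = "is_extremal \<alpha> \<zeta>"])
qed

lemma is_extremal_pre_schwarzian:
  assumes "cmod \<zeta> = 1" "is_extremal \<alpha> \<zeta> h" "z \<in> unit_disc"
  shows "deriv h z \<noteq> 0"
    and "deriv (deriv h) z / deriv h z = - of_real \<alpha> * \<zeta> / (1 - z * \<zeta>)"
proof -
  have eq: "\<And>z. z \<in> unit_disc \<Longrightarrow> deriv h z = (1 - \<zeta> * z) powr of_real \<alpha>"
    using assms by (auto simp: is_extremal_def)
  have nz: "1 - \<zeta> * z \<noteq> 0"
    using Re_one_minus_pos[OF assms(1,3)] by (auto simp del: times_complex.sel)
  then show "deriv h z \<noteq> 0"
    using eq[OF assms(3)] by simp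
  \<comment> \<open>\<open>deriv h\<close> is known to be the power only on the disc, so the
    derivative is transferred within that open set.\<close>
  have "(deriv h has_field_derivative
      - of_real \<alpha> * \<zeta> / (1 - \<zeta> * z) * (1 - \<zeta> * z) powr of_real \<alpha>) (at z)"
    by (rule has_field_derivative_transform_within_open
        [OF has_field_derivative_one_minus_powr[OF assms(1,3)] open_ball assms(3)])
       (simp add: eq)
  then have "deriv (deriv h) z = - of_real \<alpha> * \<zeta> / (1 - \<zeta> * z) * deriv h z"
    using eq[OF assms(3)] by (simp add: DERIV_imp_deriv)
  then show "deriv (deriv h) z / deriv h z = - of_real \<alpha> * \<zeta> / (1 - z * \<zeta>)"
    using \<open>deriv h z \<noteq> 0\<close> by (simp add: mult.commute)
qed

text \<open>With w = 1 - \<zeta> z the expression in the defining condition equals 1 - 1/w.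
  Inversion maps the disc |1 - w| < 1 into the half-plane of real part above 1/2: squaring gives
  |w|^2 < 2 Re w.\<close>

lemma is_extremal_in_class_G:
  assumes "0 < \<alpha>" "cmod \<zeta> = 1" "is_extremal \<alpha> \<zeta> h"
  shows "h \<in> class_G \<alpha>"
proof -
  have hol: "h holomorphic_on unit_disc" and "h 0 = 0" and "deriv h 0 = 1"
    using assms by (auto simp: is_extremal_def)
  moreover have "locally_univalent_on h unit_disc"
    using hol is_extremal_pre_schwarzian(1)[OF assms(2,3)] by (intro locally_univalent_onI) auto
  moreover have "Re (z * deriv (deriv h) z / (of_real \<alpha> * deriv h z)) < 1/2"
    if z: "z \<in> unit_disc" for z
  proof -
    define w where "w = 1 - \<zeta> * z"
    have w: "0 < Re w"
      unfolding w_def by (rule Re_one_minus_pos[OF assms(2) z])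
    have lt: "cmod (1 - w) < 1"
      using assms(2) z by (simp add: w_def norm_mult)
    have "(cmod (1 - w))\<^sup>2 < 1"
      using lt by (simp add: abs_square_less_1)
    then have "(cmod w)\<^sup>2 < 2 * Re w"
      by (simp only: cmod_power2) (simp add: power2_eq_square algebra_simps)
    moreover have "Re (1 / w) = Re w / (cmod w)\<^sup>2"
      by (simp add: Re_divide cmod_power2)
    moreover have "0 < (cmod w)\<^sup>2"
      using w by auto
    ultimately have "1/2 < Re (1 / w)"
      by (simp add: less_divide_eq)
    have "z * deriv (deriv h) z / (of_real \<alpha> * deriv h z)
        = z / of_real \<alpha> * (deriv (deriv h) z / deriv h z)"
      by simp
    also have "\<dots> = - (\<zeta> * z) / w"
      using assms(1) by (simp add: is_extremal_pre_schwarzian(2)[OF assms(2,3) z] w_def mult_ac)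
    also have "- (\<zeta> * z) = w - 1"
      by (simp add: w_def)
    also have "(w - 1) / w = 1 - 1 / w"
      using w by (auto simp: diff_divide_distrib)
    finally show ?thesis
      using \<open>1/2 < Re (1 / w)\<close> by simp
  qed
  ultimately show ?thesis
    by (simp add: class_G_def)
qed

text \<open>On this radius z \<zeta> = r, so the denominator (1 - z \<zeta>)^2 cancels the factor (1
  - r)^2 of the weight and only (1 + r)^2 survives.\<close>

lemma is_extremal_schwarzian_radial:
  assumes \<alpha>: "0 < \<alpha>" and \<zeta>: "cmod \<zeta> = 1" and h: "is_extremal \<alpha> \<zeta> h"
    and r: "0 \<le> r" "r < 1"
  defines "z \<equiv> of_real r * cnj \<zeta>"
  shows "(1 - (cmod z)\<^sup>2)\<^sup>2 * cmod (schwarzian h z) = \<alpha> * (1 + \<alpha> / 2) * (1 + r)\<^sup>2"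
proof -
  have cz: "cmod z = r"
    using \<zeta> r by (simp add: z_def norm_mult)
  then have z: "z \<in> unit_disc"
    using r by simp
  have "cnj \<zeta> * \<zeta> = 1"
    using complex_norm_square[of \<zeta>] \<zeta> by (simp add: mult.commute)
  then have den: "1 - z * \<zeta> = of_real (1 - r)"
    by (simp add: z_def mult.assoc)
  have nz: "1 - w * \<zeta> \<noteq> 0" if "w \<in> unit_disc" for w
    using Re_one_minus_pos[OF \<zeta> that] by (auto simp: mult.commute simp del: times_complex.sel)
  have "schwarzian h z
      = - of_real \<alpha> * (deriv (\<lambda>_. \<zeta>) z + (1 + of_real \<alpha> / 2) * \<zeta>\<^sup>2) / (1 - z * \<zeta>)\<^sup>2"
    by (rule schwarzian_eq[OF open_ball z _ nz is_extremal_pre_schwarzian(2)[OF \<zeta> h]]) auto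
  also have "\<dots> = - of_real (\<alpha> * (1 + \<alpha> / 2)) * \<zeta>\<^sup>2 / (of_real (1 - r))\<^sup>2"
    by (simp add: den)
  finally have "cmod (schwarzian h z) = \<alpha> * (1 + \<alpha> / 2) / (1 - r)\<^sup>2"
    using \<alpha> r \<zeta> by (simp only: norm_divide norm_mult norm_power norm_minus_cancel norm_of_real) simp
  moreover have "(1 - r\<^sup>2)\<^sup>2 = (1 - r)\<^sup>2 * (1 + r)\<^sup>2"
    by (simp add: power2_eq_square algebra_simps)
  ultimately show ?thesis
    using r by (simp add: cz)
qed

theorem theorem3p4:
  fixes \<alpha> :: real
  assumes "0 < \<alpha>" and "\<alpha> \<le> 1"
  shows "(\<forall>h\<in>class_G \<alpha>. schwarzian_norm h \<le> ereal (2 * \<alpha> * (2 + \<alpha>))) \<and>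
    (\<forall>\<zeta>. cmod \<zeta> = 1 \<longrightarrow>
      (\<exists>h. is_extremal \<alpha> \<zeta> h) \<and>
      (\<forall>h. is_extremal \<alpha> \<zeta> h \<longrightarrow>
        h \<in> class_G \<alpha> \<and> schwarzian_norm h = ereal (2 * \<alpha> * (2 + \<alpha>))))"
proof -
  have upper: "schwarzian_norm h \<le> ereal (2 * \<alpha> * (2 + \<alpha>))" if "h \<in> class_G \<alpha>" for h
    unfolding schwarzian_norm_def
    using class_G_schwarzian_bound[OF assms(1) that] by (intro SUP_least) simp
  have lower: "ereal (2 * \<alpha> * (2 + \<alpha>)) \<le> schwarzian_norm h"
    if \<zeta>: "cmod \<zeta> = 1" and h: "is_extremal \<alpha> \<zeta> h" for \<zeta> h
  proof -
    have le: "ereal (\<alpha> * (1 + \<alpha> / 2) * (1 + r)\<^sup>2) \<le> schwarzian_norm h" if r: "0 \<le> r" "r < 1" for r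
      unfolding schwarzian_norm_def is_extremal_schwarzian_radial[OF assms(1) \<zeta> h r, symmetric]
      by (rule SUP_upper) (use \<zeta> r in \<open>simp add: norm_mult\<close>)
    have ev: "\<forall>\<^sub>F r in at_left 1. ereal (\<alpha> * (1 + \<alpha> / 2) * (1 + r)\<^sup>2) \<le> schwarzian_norm h"
      by (rule eventually_mono[OF eventually_at_left_real[of 0 1]]) (auto intro: le)
    \<comment> \<open>As r tends to 1 the radial values tend to 4 \<alpha> (1 + \<alpha>/2) = 2
      \<alpha> (2 + \<alpha>); the supremum dominates each of them and hence their limit.\<close>
    have "((\<lambda>r. ereal (\<alpha> * (1 + \<alpha> / 2) * (1 + r)\<^sup>2)) \<longlongrightarrow>
        ereal (\<alpha> * (1 + \<alpha> / 2) * (1 + 1)\<^sup>2)) (at_left 1)"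
      by (intro tendsto_intros)
    then have "ereal (\<alpha> * (1 + \<alpha> / 2) * (1 + 1)\<^sup>2) \<le> schwarzian_norm h"
      by (rule tendsto_upperbound[OF _ ev]) simp
    then show ?thesis
      by (simp add: algebra_simps power2_eq_square)
  qed
  show ?thesis
    using upper lower exists_is_extremal is_extremal_in_class_G[OF assms(1)]
    by (auto intro: antisym)
qed

end
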